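(* Let $X$ be a regular space. The following properties are equivalent: (a) $X$ is Lindelöf and linearly H-closed; (b) $X$ satisfies $\mathsf{U}_{fin}(\mathcal{O},\Delta)$; (c) $X$ is compact.
   Context: By convention "regular" includes Hausdorff. A cover always means a cover by open sets; a chain cover is a cover linearly ordered by inclusion. A space $X$ is linearly H-closed if every chain cover of $X$ has a member dense in $X$. A space is Lindelöf (resp. compact) if every cover has a countable (resp. finite) subcover; no separation axiom is included in these properties. $\mathcal{O}$ is the collection of all covers of $X$, and $\Delta$ is the collection of od-covers of $X$, i.e. covers all of whose members are (open and) dense in $X$. For collections $\mathcal{A},\mathcal{B}$ of covers of $X$, $X$ satisfies $\mathsf{U}_{fin}(\mathcal{A},\mathcal{B})$ if for each sequence $\langle\mathcal{U}_n : n\in\omega\rangle$ of members of $\mathcal{A}$, none of which has a finite subcover, there are finite $\mathcal{F}_n\subset\mathcal{U}_n$ such that $\{\bigcup\mathcal{F}_n : n\in\omega\}\in\mathcal{B}$. *)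

theory Defs
  imports "HOL-Analysis.Analysis"
begin

definition open_covers :: "'a topology \<Rightarrow> 'a set set set" where
  "open_covers X = {\<U>. (\<forall>U\<in>\<U>. openin X U) \<and> \<Union>\<U> = topspace X}"

definition dense_set :: "'a topology \<Rightarrow> 'a set \<Rightarrow> bool" where
  "dense_set X D \<longleftrightarrow> D \<subseteq> topspace X \<and> X closure_of D = topspace X"

definition od_covers :: "'a topology \<Rightarrow> 'a set set set" where
  "od_covers X = {\<U> \<in> open_covers X. \<forall>U\<in>\<U>. dense_set X U}"

text \<open>
  The requirement \<open>\<U> \<noteq> {}\<close> matters only for the empty space: there the empty family is
  a cover without any member, and without this requirement the empty space would be compact
  but not linearly H-closed. A cover of a nonempty space is automatically nonempty.
\<close>

definition chain_covers :: "'a topology \<Rightarrow> 'a set set set" where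
  "chain_covers X = {\<U> \<in> open_covers X. chain_subset \<U> \<and> \<U> \<noteq> {}}"

definition linearly_H_closed :: "'a topology \<Rightarrow> bool" where
  "linearly_H_closed X \<longleftrightarrow> (\<forall>\<U>\<in>chain_covers X. \<exists>U\<in>\<U>. dense_set X U)"

definition has_finite_subcover :: "'a topology \<Rightarrow> 'a set set \<Rightarrow> bool" where
  "has_finite_subcover X \<U> \<longleftrightarrow> (\<exists>\<F>. finite \<F> \<and> \<F> \<subseteq> \<U> \<and> \<Union>\<F> = topspace X)"

definition U_fin :: "'a topology \<Rightarrow> 'a set set set \<Rightarrow> 'a set set set \<Rightarrow> bool" where
  "U_fin X \<A> \<B> \<longleftrightarrow>
     (\<forall>\<U> :: nat \<Rightarrow> 'a set set.
        (\<forall>n. \<U> n \<in> \<A> \<and> \<not> has_finite_subcover X (\<U> n)) \<longrightarrow>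
        (\<exists>\<F> :: nat \<Rightarrow> 'a set set.
           (\<forall>n. finite (\<F> n) \<and> \<F> n \<subseteq> \<U> n) \<and> range (\<lambda>n. \<Union>(\<F> n)) \<in> \<B>))"

end

theory Submission
  imports Defs
begin

text \<open>
  In a regular space a cover has a refinement by open sets whose closures lie in members of the
  cover, so it is enough to find, for every open cover, a finite subfamily with dense union: finite
  unions commute with closures. Linear H-closedness provides such a subfamily through the increasing
  finite unions of a countable subcover, and \<open>U_fin\<close> provides it through a constant sequence of covers.
\<close>

lemma compact_space_iff_has_finite_subcover:
  "compact_space X \<longleftrightarrow> (\<forall>\<U>\<in>open_covers X. has_finite_subcover X \<U>)"
  by (simp add: compact_space open_covers_def has_finite_subcover_def)

lemma compact_space_if_finite_dense_subfamily:
  assumes "regular_space X"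
    and dense: "\<And>\<V>. \<V> \<in> open_covers X \<Longrightarrow> \<exists>\<F>. finite \<F> \<and> \<F> \<subseteq> \<V> \<and> dense_set X (\<Union>\<F>)"
  shows "compact_space X"
  unfolding compact_space_iff_has_finite_subcover
proof
  fix \<U> assume \<U>: "\<U> \<in> open_covers X"
  \<comment> \<open>Taking all open sets with this closure property, rather than choosing one for
    each point, makes the refinement canonical. Regularity is what makes it a cover.\<close>
  define \<V> where "\<V> = {V. openin X V \<and> (\<exists>U\<in>\<U>. X closure_of V \<subseteq> U)}"
  have cover: "\<And>U. U \<in> \<U> \<Longrightarrow> openin X U" "\<Union>\<U> = topspace X"
    using \<U> by (simp_all add: open_covers_def)
  have "x \<in> \<Union>\<V>" if x: "x \<in> topspace X" for x
  proof -
    obtain U where U: "U \<in> \<U>" "x \<in> U"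
      using x unfolding cover(2)[symmetric] by blast
    have "neighbourhood_base_of (closedin X) X"
      using assms(1) by (simp add: neighbourhood_base_of_closedin)
    then obtain V C where V: "openin X V" "closedin X C" "x \<in> V" "V \<subseteq> C" "C \<subseteq> U"
      using cover(1)[OF U(1)] U(2) unfolding neighbourhood_base_of by metis
    have "X closure_of V \<subseteq> U"
      using closure_of_minimal[OF V(4,2)] V(5) by (rule subset_trans)
    then have "V \<in> \<V>"
      using U(1) V(1) unfolding \<V>_def by blast
    then show ?thesis
      using V(3) by (rule UnionI)
  qed
  moreover have "openin X V" if "V \<in> \<V>" for V
    using that by (simp add: \<V>_def)
  ultimately have "\<V> \<in> open_covers X"
    unfolding open_covers_def by (simp add: subset_antisym Union_least openin_subset subsetI)
  from dense[OF this] obtain \<F> where \<F>: "finite \<F>" "\<F> \<subseteq> \<V>" "dense_set X (\<Union>\<F>)"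
    by metis
  have "\<exists>U\<in>\<U>. X closure_of V \<subseteq> U" if "V \<in> \<F>" for V
    using \<F>(2) that unfolding \<V>_def by blast
  then obtain u where u: "\<And>V. V \<in> \<F> \<Longrightarrow> u V \<in> \<U>" "\<And>V. V \<in> \<F> \<Longrightarrow> X closure_of V \<subseteq> u V"
    by metis
  \<comment> \<open>Finiteness of \<open>\<F>\<close> lets the closure pass inside the union; each
    closure then sits in its chosen \<open>u V\<close>, so the sets \<open>u V\<close> form the
    finite subcover.\<close>
  have "topspace X = (\<Union>V\<in>\<F>. X closure_of V)"
    using \<F>(3) closure_of_Union[OF \<F>(1), of X] unfolding dense_set_def by metis
  also have "\<dots> \<subseteq> \<Union>(u ` \<F>)"
    using u(2) by (rule UN_mono[OF subset_refl])
  finally have "topspace X \<subseteq> \<Union>(u ` \<F>)" .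
  moreover have "u ` \<F> \<subseteq> \<U>"
    using u(1) by (rule image_subsetI)
  moreover from this have "\<Union>(u ` \<F>) \<subseteq> topspace X"
    unfolding cover(2)[symmetric] by (rule Union_mono)
  ultimately show "has_finite_subcover X \<U>"
    unfolding has_finite_subcover_def using finite_imageI[OF \<F>(1)] subset_antisym by metis
qed

lemma finite_dense_subfamily_if_linearly_H_closed:
  assumes "Lindelof_space X" and "linearly_H_closed X" and "\<V> \<in> open_covers X"
  shows "\<exists>\<F>. finite \<F> \<and> \<F> \<subseteq> \<V> \<and> dense_set X (\<Union>\<F>)"
proof -
  obtain \<C> where \<C>: "countable \<C>" "\<C> \<subseteq> \<V>" "\<Union>\<C> = topspace X"
    using assms(1,3) unfolding Lindelof_space_def open_covers_def mem_Collect_eq by metis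
  show ?thesis
  \<comment> \<open>Enumerating \<open>\<C>\<close> by the naturals needs a member. If there is
    none, the space is empty and the empty family already has dense union.\<close>
  proof (cases "\<C> = {}")
    case True
    then show ?thesis
      using \<C> by (intro exI[of _ "{}"]) (auto simp: dense_set_def)
  next
    case False
    define f where "f = from_nat_into \<C>"
    have f: "range f = \<C>"
      using \<C>(1) False by (simp add: f_def)
    \<comment> \<open>The partial unions form a chain cover, and a dense \<open>W n\<close> is by
      construction the union of a finite subfamily.\<close>
    define W where "W n = \<Union>(f ` {..n})" for n :: nat
    have mono: "W m \<subseteq> W n" if "m \<le> n" for m n
      unfolding W_def using that by (auto intro: order_trans)
    have "chain_subset (range W)"
      unfolding chain_subset_def using mono nat_le_linear by blast
    moreover have "openin X (W n)" for n
      using f \<C>(2) assms(3) by (auto simp: W_def open_covers_def)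
    moreover have "(\<Union>n. W n) = topspace X"
      unfolding \<C>(3)[symmetric] f[symmetric] by (auto simp: W_def)
    ultimately have "range W \<in> chain_covers X"
      by (auto simp: chain_covers_def open_covers_def)
    then obtain n where "dense_set X (W n)"
      using assms(2) by (auto simp: linearly_H_closed_def)
    then show ?thesis
      using f \<C>(2) by (intro exI[of _ "f ` {..n}"]) (auto simp: W_def)
  qed
qed

text \<open>\<open>U_fin\<close> speaks only about covers without a finite subcover, hence the case
  split; a finite subcover has the whole space as its union, which is dense.\<close>

lemma finite_dense_subfamily_if_U_fin:
  assumes "U_fin X (open_covers X) (od_covers X)" and "\<V> \<in> open_covers X"
  shows "\<exists>\<F>. finite \<F> \<and> \<F> \<subseteq> \<V> \<and> dense_set X (\<Union>\<F>)"
proof (cases "has_finite_subcover X \<V>")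
  case True
  then show ?thesis
    unfolding has_finite_subcover_def dense_set_def by (metis closure_of_topspace subset_refl)
next
  case False
  then obtain \<F> :: "nat \<Rightarrow> 'a set set"
    where "\<forall>n. finite (\<F> n) \<and> \<F> n \<subseteq> \<V>" "range (\<lambda>n. \<Union>(\<F> n)) \<in> od_covers X"
    using assms(1)[unfolded U_fin_def, rule_format, of "\<lambda>_. \<V>"] assms(2) by auto
  then show ?thesis
    \<comment> \<open>Every member of an od-cover is dense, so any index would do in place of
      0.\<close>
    by (intro exI[of _ "\<F> 0"]) (auto simp: od_covers_def)
qed

text \<open>A nonempty finite chain contains its own union, so a chain cover of a compact space has
  the whole space as a member.\<close>

lemma compact_imp_linearly_H_closed:
  assumes "compact_space X"
  shows "linearly_H_closed X"
  unfolding linearly_H_closed_def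
proof
  fix \<U> assume \<U>: "\<U> \<in> chain_covers X"
  then obtain \<F> where \<F>: "finite \<F>" "\<F> \<subseteq> \<U>" "\<Union>\<F> = topspace X"
    using assms unfolding compact_space_iff_has_finite_subcover has_finite_subcover_def chain_covers_def
    by (metis (no_types, lifting) mem_Collect_eq)
  have "topspace X \<in> \<U>"
  proof (cases "\<F> = {}")
    \<comment> \<open>In the empty space a chain cover still has a member, which can only be the
      empty set, that is, the whole space.\<close>
    case True
    then have "topspace X = {}" using \<F> by simp
    with \<U> show ?thesis
      by (auto simp: chain_covers_def open_covers_def)
  next
    case False
    have "subset.chain \<U> \<F>"
      using \<U> \<F>(2) by (auto simp: chain_covers_def chain_subset_def subset.chain_def)
    then have "\<Union>\<F> \<in> \<F>"
      using Union_in_chain[OF \<F>(1) False] by blast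
    then show ?thesis using \<F> by auto
  qed
  then show "\<exists>U\<in>\<U>. dense_set X U"
    by (auto simp: dense_set_def)
qed

theorem proposition3p3:
  fixes X :: "'a topology"
  assumes "regular_space X" and "Hausdorff_space X"
  shows "(Lindelof_space X \<and> linearly_H_closed X \<longleftrightarrow> U_fin X (open_covers X) (od_covers X)) \<and>
         (U_fin X (open_covers X) (od_covers X) \<longleftrightarrow> compact_space X)"
proof -
  have "compact_space X" if "Lindelof_space X" "linearly_H_closed X"
    using assms(1) finite_dense_subfamily_if_linearly_H_closed[OF that]
    by (rule compact_space_if_finite_dense_subfamily)
  moreover have "compact_space X" if "U_fin X (open_covers X) (od_covers X)"
    using assms(1) finite_dense_subfamily_if_U_fin[OF that]
    by (rule compact_space_if_finite_dense_subfamily)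
  \<comment> \<open>This holds vacuously: in a compact space no open cover lacks a finite
    subcover.\<close>
  moreover have "U_fin X (open_covers X) (od_covers X)" if "compact_space X"
    using that by (auto simp: U_fin_def compact_space_iff_has_finite_subcover)
  ultimately show ?thesis
    using compact_imp_Lindelof_space compact_imp_linearly_H_closed by blast
qed

end
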